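(* Let $n\ge2$, let $D\Subset\left(-\frac12,\frac12\right)^n$ be an open connected set with $C^1$ boundary containing $0$ such that $\Omega=\mathbb{R}^n\setminus\bigcup_{m\in\mathbb{Z}^n}(m+\overline D)$ is connected. Let $$H(y,p)=\frac{a(y)|p|^2}{2}\qquad\text{for }(y,p)\in\mathbb{R}^n\times\mathbb{R}^n,$$ where $a\in C(\mathbb{R}^n)$ is $\mathbb{Z}^n$-periodic, $a=1$ on $\overline\Omega$ and $a>1$ in $\mathbb{R}^n\setminus\overline\Omega$. Let $I=\{me_1:\ m\in\mathbb{N}\cup\{0\}\}$ and $$W=\mathbb{R}^n\setminus\bigcup_{m\in\mathbb{Z}^n\setminus I}(m+\overline D),\qquad W_\varepsilon=\varepsilon W .$$ Let $g(x)=-x_1$ for $x\in\mathbb{R}^n$. For $\varepsilon>0$ let $w^\varepsilon$ be the unique viscosity solution of the state-constraint problem $$w^\varepsilon_t+H\left(\tfrac x\varepsilon,Dw^\varepsilon\right)\le0\ \text{ in }W_\varepsilon\times(0,\infty),\quad w^\varepsilon_t+H\left(\tfrac x\varepsilon,Dw^\varepsilon\right)\ge0\ \text{ on }\overline W_\varepsilon\times(0,\infty),\quad w^\varepsilon(\cdot,0)=g\ \text{ on }\overline W_\varepsilon,$$ and let $u$ be the unique viscosity solution of $u_t+\overline H(Du)=0$ in $\mathbb{R}^n\times(0,\infty)$, $u(\cdot,0)=g$, where $\overline H=\overline H_\Omega$ is the effective Hamiltonian of the state-constraint cell problem on $\overline\Omega$. Then $$\limsup_{\varepsilon\to0}w^\varepsilon(0,1)<u(0,1)=-\frac12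 .$$
   Context: $\{e_1,\dots,e_n\}$ is the canonical basis of $\mathbb{R}^n$. State-constraint viscosity solutions: $w^\varepsilon$, continuous on $\overline W_\varepsilon\times[0,\infty)$, is a viscosity subsolution in $W_\varepsilon\times(0,\infty)$ in the usual sense and a supersolution on $\overline W_\varepsilon\times(0,\infty)$, i.e. test functions touching from below relative to $\overline W_\varepsilon\times(0,\infty)$ satisfy the inequality $\ge0$. Equivalently, with $L(y,v)=\sup_p(p\cdot v-H(y,p))=\frac{|v|^2}{2a(y)}$, $$w^\varepsilon(x,t)=\inf\left\{\int_0^tL\left(\tfrac{\xi(s)}\varepsilon,\dot\xi(s)\right)ds+g(\xi(0)):\ \xi\in\mathrm{AC}([0,t];\overline W_\varepsilon),\ \xi(t)=x\right\},$$ where $\mathrm{AC}(J;U)$ denotes absolutely continuous curves $J\to U$. Effective Hamiltonian: for $p\in\mathbb{R}^n$, $\overline H(p)$ is the unique constant for which $H(y,p+Dv)\le\overline H(p)$ in $\Omega$, $H(y,p+Dv)\ge\overline H(p)$ on $\overline\Omega$ (state-constraint viscosity sense) has a $\mathbb{Z}^n$-periodic solution $v$. *)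

theory Defs
  imports "HOL-Analysis.Analysis"
begin

definition int_lattice :: "(real^'n) set" where
  "int_lattice = {m. \<forall>i. m $ i \<in> \<int>}"

definition lattice_periodic_on :: "(real^'n) set \<Rightarrow> (real^'n \<Rightarrow> real) \<Rightarrow> bool" where
  "lattice_periodic_on S f \<longleftrightarrow> (\<forall>y\<in>S. \<forall>m\<in>int_lattice. f (y + m) = f y)"

definition perforated :: "(real^'n) set \<Rightarrow> (real^'n) set \<Rightarrow> (real^'n) set" where
  "perforated M D = UNIV - (\<Union>m\<in>M. (\<lambda>x. m + x) ` closure D)"

definition C1_with_gradient :: "('a::euclidean_space \<Rightarrow> real) \<Rightarrow> ('a \<Rightarrow> 'a) \<Rightarrow> bool" where
  "C1_with_gradient \<phi> G \<longleftrightarrow> (\<forall>x. GDERIV \<phi> x :> G x) \<and> continuous_on UNIV G"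

text \<open>Near each boundary point the set is one side of the graph of a \<open>C\<^sup>1\<close> function of the
  other \<open>n - 1\<close> coordinates, after relabelling (the index \<open>i\<close>) and reorienting (the sign \<open>s\<close>)
  the coordinate axes.  A function of \<open>n - 1\<close> coordinates is encoded as a function on the
  whole space that does not depend on coordinate \<open>i\<close>.\<close>

definition C1_boundary :: "(real^'n) set \<Rightarrow> bool" where
  "C1_boundary D \<longleftrightarrow>
    (\<forall>x0\<in>frontier D. \<exists>r>0. \<exists>i. \<exists>s\<in>{1, -1}. \<exists>\<gamma> G.
        C1_with_gradient \<gamma> G \<and>
        (\<forall>x y. (\<forall>j. j \<noteq> i \<longrightarrow> x $ j = y $ j) \<longrightarrow> \<gamma> x = \<gamma> y) \<and>
        D \<inter> ball x0 r = {x \<in> ball x0 r. s * x $ i > \<gamma> x})"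

text \<open>Viscosity inequalities \<open>F(x, Du) \<le> 0\<close> and \<open>F(x, Du) \<ge> 0\<close> on \<open>S\<close>.  Touching is local and
  relative to \<open>S\<close>, which need not be open: the supersolution property on a closed set \<open>S\<close>
  is the state-constraint boundary condition.\<close>

definition viscosity_sub_on ::
    "('a::euclidean_space) set \<Rightarrow> ('a \<Rightarrow> 'a \<Rightarrow> real) \<Rightarrow> ('a \<Rightarrow> real) \<Rightarrow> bool" where
  "viscosity_sub_on S F u \<longleftrightarrow>
    (\<forall>\<phi> G x0. C1_with_gradient \<phi> G \<longrightarrow> x0 \<in> S \<longrightarrow>
       (\<forall>\<^sub>F x in at x0 within S. u x - \<phi> x \<le> u x0 - \<phi> x0) \<longrightarrow> F x0 (G x0) \<le> 0)"

definition viscosity_super_on ::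
    "('a::euclidean_space) set \<Rightarrow> ('a \<Rightarrow> 'a \<Rightarrow> real) \<Rightarrow> ('a \<Rightarrow> real) \<Rightarrow> bool" where
  "viscosity_super_on S F u \<longleftrightarrow>
    (\<forall>\<phi> G x0. C1_with_gradient \<phi> G \<longrightarrow> x0 \<in> S \<longrightarrow>
       (\<forall>\<^sub>F x in at x0 within S. u x - \<phi> x \<ge> u x0 - \<phi> x0) \<longrightarrow> F x0 (G x0) \<ge> 0)"

text \<open>The operator \<open>w\<^sub>t + H(x, Dw)\<close> as a function of the space-time point \<open>(x, t)\<close> and the
  space-time gradient \<open>(Dw, w\<^sub>t)\<close>.\<close>

definition evolution_op ::
    "(real^'n \<Rightarrow> real^'n \<Rightarrow> real) \<Rightarrow> ((real^'n) \<times> real) \<Rightarrow> ((real^'n) \<times> real) \<Rightarrow> real" where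
  "evolution_op H z q = snd q + H (fst z) (fst q)"

definition state_constraint_solution ::
    "(real^'n) set \<Rightarrow> (real^'n \<Rightarrow> real^'n \<Rightarrow> real) \<Rightarrow> (real^'n \<Rightarrow> real) \<Rightarrow>
     ((real^'n) \<times> real \<Rightarrow> real) \<Rightarrow> bool" where
  "state_constraint_solution V H g w \<longleftrightarrow>
     continuous_on (closure V \<times> {0..}) w \<and>
     viscosity_sub_on (V \<times> {0<..}) (evolution_op H) w \<and>
     viscosity_super_on (closure V \<times> {0<..}) (evolution_op H) w \<and>
     (\<forall>x\<in>closure V. w (x, 0) = g x)"

definition cauchy_solution ::
    "(real^'n \<Rightarrow> real) \<Rightarrow> (real^'n \<Rightarrow> real) \<Rightarrow> ((real^'n) \<times> real \<Rightarrow> real) \<Rightarrow> bool" where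
  "cauchy_solution h g u \<longleftrightarrow>
     continuous_on (UNIV \<times> {0..}) u \<and>
     viscosity_sub_on (UNIV \<times> {0<..}) (evolution_op (\<lambda>x. h)) u \<and>
     viscosity_super_on (UNIV \<times> {0<..}) (evolution_op (\<lambda>x. h)) u \<and>
     (\<forall>x. u (x, 0) = g x)"

definition cell_solution ::
    "(real^'n) set \<Rightarrow> (real^'n \<Rightarrow> real^'n \<Rightarrow> real) \<Rightarrow> real^'n \<Rightarrow> real \<Rightarrow>
     (real^'n \<Rightarrow> real) \<Rightarrow> bool" where
  "cell_solution \<Omega> H p c v \<longleftrightarrow>
     continuous_on (closure \<Omega>) v \<and>
     lattice_periodic_on (closure \<Omega>) v \<and>
     viscosity_sub_on \<Omega> (\<lambda>y q. H y (p + q) - c) v \<and>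
     viscosity_super_on (closure \<Omega>) (\<lambda>y q. H y (p + q) - c) v"

text \<open>\<open>Hbar p\<close> is the unique constant for which the state-constraint cell problem at \<open>p\<close> has
  a periodic solution.\<close>

definition effective_hamiltonian ::
    "(real^'n) set \<Rightarrow> (real^'n \<Rightarrow> real^'n \<Rightarrow> real) \<Rightarrow> (real^'n \<Rightarrow> real) \<Rightarrow> bool" where
  "effective_hamiltonian \<Omega> H Hbar \<longleftrightarrow>
     (\<forall>p c. (\<exists>v. cell_solution \<Omega> H p c v) \<longleftrightarrow> c = Hbar p)"

end

theory Submission
  imports Defs
begin

text \<open>A viscosity subsolution of \<open>b \<bullet> Du \<le> c\<close> grows at rate at most \<open>c\<close> along lines of direction
  \<open>b\<close>; this replaces the control representation.  Since \<open>a |p|\<^sup>2 / 2 \<ge> v \<bullet> p - |v|\<^sup>2 / (2 a)\<close>, applying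
  it to a corrector along a coordinate line between the holes gives \<open>Hbar p \<ge> p\<^sub>i\<^sup>2 / 2\<close>, while the
  corrector's minimum gives \<open>Hbar p \<le> |p|\<^sup>2 / 2\<close>.  Hence \<open>u(0,1) \<le> -1/2\<close> by following a line at
  unit speed.  The opposite inequality is a comparison with \<open>-x\<^sub>k - t/2\<close>; no growth is assumed on
  \<open>u\<close>, but following a line from \<open>(x,t)\<close> to \<open>(0,T)\<close> with \<open>T\<close> large bounds \<open>u\<close> from
  below by \<open>-C - \<delta> |x|\<^sup>2\<close> with \<open>\<delta>\<close> arbitrarily small.  For \<open>w\<close>, the unit speed path from \<open>e\<^sub>k\<close> to
  \<open>0\<close> along the axis spends a fixed proportion of its time in the filled holes where
  \<open>a \<ge> \<alpha> > 1\<close>, so it costs less than \<open>1/2\<close> by an amount independent of \<open>\<epsilon>\<close>.\<close>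

section \<open>Growth of viscosity subsolutions along segments\<close>

lemma C1_with_gradient_quadratic:
  "C1_with_gradient (\<lambda>y. M * (norm (y - z))\<^sup>2) (\<lambda>y. (2 * M) *\<^sub>R (y - z))"
  unfolding C1_with_gradient_def gderiv_def power2_norm_eq_inner
  by (auto intro!: derivative_eq_intros continuous_intros simp: algebra_simps inner_commute)

text \<open>Otherwise a penalised function \<open>\<Phi>\<close> on a thin tube around the segment
  has a maximum at some \<open>(s, z)\<close> with \<open>s > 0\<close> and \<open>z\<close> off the
  lateral boundary. Varying \<open>z\<close> alone yields a test function. Trading \<open>s\<close>
  against \<open>z\<close> so that the point \<open>x + s b + z\<close> stays fixed compares only
  the explicit terms. The two moves bound \<open>b \<bullet> q\<close> from opposite sides,
  incompatibly.\<close>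

lemma viscosity_sub_on_segment_le:
  fixes u :: "'a::euclidean_space \<Rightarrow> real"
  assumes sub: "viscosity_sub_on V F u"
    and S: "open S" "S \<subseteq> V" "continuous_on S u"
    and "T \<ge> 0"
    and segment: "\<And>s. s \<in> {0..T} \<Longrightarrow> x + s *\<^sub>R b \<in> S"
    and F_ge: "\<And>y q. y \<in> S \<Longrightarrow> b \<bullet> q - c \<le> F y q"
  shows "u (x + T *\<^sub>R b) \<le> u x + c * T"
proof (rule ccontr)
  assume neg: "\<not> ?thesis"
  define d where "d = u (x + T *\<^sub>R b) - u x - c * T"
  have "d > 0" using neg by (simp add: d_def)
  have "T > 0" using \<open>T \<ge> 0\<close> \<open>d > 0\<close> by (cases "T = 0") (auto simp: d_def)
  \<comment> \<open>Half of the excess slope \<open>d / T\<close>: the slope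
    \<open>c + \<delta>\<close> still leaves an excess \<open>d / 2\<close> at the end of the
    segment.\<close>
  define \<delta> where "\<delta> = d / (2 * T)"
  have "\<delta> > 0" using \<open>d > 0\<close> \<open>T > 0\<close> by (simp add: \<delta>_def)
  let ?P = "(\<lambda>s. x + s *\<^sub>R b) ` {0..T}"
  have "compact ?P"
    by (intro compact_continuous_image continuous_intros) auto
  moreover have "?P \<subseteq> S" using segment by auto
  ultimately obtain r1 where r1: "r1 > 0" "(\<Union>y\<in>?P. cball y r1) \<subseteq> S"
    using compact_subset_open_imp_cball_epsilon_subset[of ?P S] S(1) by blast
  have "x \<in> S" using segment[of 0] \<open>T \<ge> 0\<close> by simp
  then obtain r2 where r2: "r2 > 0" "\<And>y. y \<in> S \<Longrightarrow> dist y x < r2 \<Longrightarrow> dist (u y) (u x) < d / 2"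
    using S(3) \<open>d > 0\<close> unfolding continuous_on_iff by (metis half_gt_zero)
  define r where "r = min r1 (r2 / 2)"
  have r: "r > 0" "r \<le> r1" "r < r2" using r1(1) r2(1) by (auto simp: r_def)
  let ?K = "{0..T} \<times> cball (0::'a) r"
  have in_S: "x + s *\<^sub>R b + z \<in> S" if "(s, z) \<in> ?K" for s z
  proof -
    have "x + s *\<^sub>R b + z \<in> cball (x + s *\<^sub>R b) r1"
      using that r(2) by (simp add: dist_norm)
    then show ?thesis using r1(2) that by (metis (no_types, lifting) UN_I image_eqI mem_Sigma_iff subsetD)
  qed
  have "compact ?K" by (intro compact_Times) auto
  have cont_u: "continuous_on ?K (\<lambda>p. u (x + fst p *\<^sub>R b + snd p))"
    by (rule continuous_on_compose2[OF S(3)]) (auto intro!: continuous_intros in_S simp del: mem_cball_0)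
  have "?K \<noteq> {}" using \<open>T > 0\<close> r(1) by (auto simp del: mem_cball_0)
  \<comment> \<open>This first maximum \<open>B\<close>, of \<open>u\<close> itself over the tube,
    only serves to choose \<open>M\<close>.\<close>
  from continuous_attains_sup[OF \<open>compact ?K\<close> this cont_u]
  obtain p where p: "\<forall>p'\<in>?K. u (x + fst p' *\<^sub>R b + snd p') \<le> u (x + fst p *\<^sub>R b + snd p)"
    by (elim bexE)
  define B where "B = u (x + fst p *\<^sub>R b + snd p)"
  have B: "u (x + s *\<^sub>R b + z) \<le> B" if "(s, z) \<in> ?K" for s z
    using bspec[OF p that] by (simp only: B_def fst_conv snd_conv)
  \<comment> \<open>Large enough that \<open>\<Phi>\<close> is at most \<open>u x\<close> where
    \<open>norm z = r\<close>, hence below \<open>\<Phi> T 0\<close>.\<close>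
  define M where "M = (\<bar>B\<bar> + \<bar>c + \<delta>\<bar> * T + \<bar>u x\<bar>) / r\<^sup>2"
  have "M \<ge> 0" using \<open>T > 0\<close> by (simp add: M_def)
  have Mr: "M * r\<^sup>2 = \<bar>B\<bar> + \<bar>c + \<delta>\<bar> * T + \<bar>u x\<bar>" using r(1) by (simp add: M_def)
  define \<Phi> where "\<Phi> = (\<lambda>s z. u (x + s *\<^sub>R b + z) - M * (norm z)\<^sup>2 - (c + \<delta>) * s)"
  have "continuous_on ?K (\<lambda>p. \<Phi> (fst p) (snd p))"
    unfolding \<Phi>_def by (intro continuous_intros cont_u)
  from continuous_attains_sup[OF \<open>compact ?K\<close> \<open>?K \<noteq> {}\<close> this]
  obtain p where p: "p \<in> ?K" "\<forall>p'\<in>?K. \<Phi> (fst p') (snd p') \<le> \<Phi> (fst p) (snd p)"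
    by (elim bexE)
  obtain s z where p_eq: "p = (s, z)" by (cases p)
  have sz: "(s, z) \<in> ?K" using p(1) p_eq by simp
  have max: "\<Phi> s' z' \<le> \<Phi> s z" if "(s', z') \<in> ?K" for s' z'
    using bspec[OF p(2) that] by (simp only: p_eq fst_conv snd_conv)
  have "\<Phi> T 0 = u x + d / 2"
    using \<open>T > 0\<close> by (simp add: \<Phi>_def d_def \<delta>_def field_simps)
  then have ge: "u x + d / 2 \<le> \<Phi> s z"
    using max[of T 0] \<open>T > 0\<close> r(1) by simp
  have "s \<noteq> 0"
  proof
    assume "s = 0"
    have "dist (x + z) x < r2" using sz r by (simp add: dist_norm)
    moreover have "x + z \<in> S" using in_S[OF sz] \<open>s = 0\<close> by simp
    ultimately have "dist (u (x + z)) (u x) < d / 2" by (rule r2(2)[rotated])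
    then have "u (x + z) < u x + d / 2" unfolding dist_real_def by linarith
    moreover have "M * (norm z)\<^sup>2 \<ge> 0" using \<open>M \<ge> 0\<close> by simp
    ultimately show False using ge \<open>s = 0\<close> by (simp add: \<Phi>_def)
  qed
  then have "s > 0" "s \<le> T" using sz by auto
  have "norm z < r"
  proof (rule ccontr)
    assume "\<not> norm z < r"
    then have "norm z = r" using sz by auto
    have "- ((c + \<delta>) * s) \<le> \<bar>(c + \<delta>) * s\<bar>" by (rule abs_ge_minus_self)
    also have "\<dots> = \<bar>c + \<delta>\<bar> * s" using \<open>s > 0\<close> by (simp add: abs_mult)
    also have "\<dots> \<le> \<bar>c + \<delta>\<bar> * T" using \<open>s \<le> T\<close> by (intro mult_left_mono) auto
    finally show False
      using ge B[OF sz] \<open>d > 0\<close> abs_ge_self[of B] abs_ge_minus_self[of "u x"]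
      unfolding \<Phi>_def \<open>norm z = r\<close> Mr by linarith
  qed
  define y where "y = x + s *\<^sub>R b + z"
  define q where "q = (2 * M) *\<^sub>R z"
  \<comment> \<open>With \<open>s\<close> frozen, \<open>u\<close> minus the quadratic centred at
    \<open>x + s b\<close> has a local maximum at \<open>y\<close>, and \<open>q\<close> is the
    gradient of that quadratic there.\<close>
  have "b \<bullet> q \<le> c"
  proof -
    have "y \<in> S" using in_S[OF sz] by (simp add: y_def)
    have "\<forall>\<^sub>F y' in nhds y. y' \<in> ball (x + s *\<^sub>R b) r"
      using \<open>norm z < r\<close> by (intro eventually_nhds_in_open) (auto simp: y_def dist_norm)
    then have "\<forall>\<^sub>F y' in at y within V. y' \<in> ball (x + s *\<^sub>R b) r"
      unfolding eventually_at_filter by (rule eventually_mono) simp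
    then have "\<forall>\<^sub>F y' in at y within V.
        u y' - M * (norm (y' - (x + s *\<^sub>R b)))\<^sup>2 \<le> u y - M * (norm (y - (x + s *\<^sub>R b)))\<^sup>2"
    proof (rule eventually_mono)
      fix y' assume "y' \<in> ball (x + s *\<^sub>R b) r"
      then have "(s, y' - (x + s *\<^sub>R b)) \<in> ?K"
        using sz by (auto simp: dist_norm norm_minus_commute)
      from max[OF this] show "u y' - M * (norm (y' - (x + s *\<^sub>R b)))\<^sup>2
          \<le> u y - M * (norm (y - (x + s *\<^sub>R b)))\<^sup>2"
        by (simp add: \<Phi>_def y_def)
    qed
    with sub C1_with_gradient_quadratic[of M "x + s *\<^sub>R b"] \<open>y \<in> S\<close> S(2)
    have "F y ((2 * M) *\<^sub>R (y - (x + s *\<^sub>R b))) \<le> 0"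
      unfolding viscosity_sub_on_def by blast
    then have "F y q \<le> 0" by (simp add: q_def y_def)
    with F_ge[OF \<open>y \<in> S\<close>, of q] show ?thesis by simp
  qed
  \<comment> \<open>Decreasing \<open>s\<close> while keeping the point \<open>y\<close> fixed gives the opposite inequality.\<close>
  moreover have "c < b \<bullet> q"
  proof -
    have "\<forall>\<^sub>F h in at_right 0. h < s \<and> norm (z + h *\<^sub>R b) < r \<and> M * h * (norm b)\<^sup>2 < \<delta>"
    proof (intro eventually_conj)
      show "\<forall>\<^sub>F h in at_right 0. h < s"
        using \<open>s > 0\<close> by (rule order_tendstoD(2)[OF tendsto_ident_at])
      have "((\<lambda>h. norm (z + h *\<^sub>R b)) \<longlongrightarrow> norm (z + 0 *\<^sub>R b)) (at_right 0)"
        by (intro tendsto_intros)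
      then show "\<forall>\<^sub>F h in at_right 0. norm (z + h *\<^sub>R b) < r"
        using \<open>norm z < r\<close> by (auto intro: order_tendstoD(2))
      have "((\<lambda>h. M * h * (norm b)\<^sup>2) \<longlongrightarrow> M * 0 * (norm b)\<^sup>2) (at_right 0)"
        by (intro tendsto_intros)
      then show "\<forall>\<^sub>F h in at_right 0. M * h * (norm b)\<^sup>2 < \<delta>"
        using \<open>\<delta> > 0\<close> by (auto intro: order_tendstoD(2))
    qed
    then have "\<forall>\<^sub>F h in at_right 0. h > 0 \<and> h < s \<and> norm (z + h *\<^sub>R b) < r \<and> M * h * (norm b)\<^sup>2 < \<delta>"
      by (rule eventually_conj[OF eventually_at_right_less])
    then obtain h where h: "h > 0" "h < s" "norm (z + h *\<^sub>R b) < r" "M * h * (norm b)\<^sup>2 < \<delta>"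
      using eventually_happens trivial_limit_at_right_real by blast
    have "(s - h, z + h *\<^sub>R b) \<in> ?K" using h \<open>s \<le> T\<close> by auto
    from max[OF this]
    have "(c + \<delta>) * h \<le> M * ((norm (z + h *\<^sub>R b))\<^sup>2 - (norm z)\<^sup>2)"
      by (simp add: \<Phi>_def algebra_simps)
    also have "\<dots> = (b \<bullet> q + M * h * (norm b)\<^sup>2) * h"
      unfolding power2_norm_eq_inner q_def
      by (simp add: inner_commute algebra_simps)
    finally have "c + \<delta> \<le> b \<bullet> q + M * h * (norm b)\<^sup>2"
      using h(1) by (metis mult_le_cancel_right_pos)
    with h(4) show ?thesis by simp
  qed
  ultimately show False by simp
qed

text \<open>The space-time direction \<open>(v, 1)\<close> turns \<open>u\<^sub>t + H\<close> into a
  bound of the form required above, with \<open>c\<close> bounding the Lagrangian at velocity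
  \<open>v\<close> on \<open>S\<close>. This is the upper bound of the control formula for one
  constant-velocity path.\<close>

lemma evolution_sub_segment_le:
  fixes u :: "(real^'n) \<times> real \<Rightarrow> real"
  assumes sub: "viscosity_sub_on (V \<times> {0<..}) (evolution_op H) u"
    and cont: "continuous_on (S \<times> {0..}) u"
    and S: "open S" "S \<subseteq> V"
    and t: "0 \<le> t0" "t0 \<le> t1"
    and segment: "\<And>t. t \<in> {t0..t1} \<Longrightarrow> x + (t - t0) *\<^sub>R v \<in> S"
    and H_ge: "\<And>y p. y \<in> S \<Longrightarrow> v \<bullet> p - c \<le> H y p"
  shows "u (x + (t1 - t0) *\<^sub>R v, t1) \<le> u (x, t0) + c * (t1 - t0)"
proof (cases "t0 = t1")
  case False
  with t have "t0 < t1" by simp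
  \<comment> \<open>The equation holds only at positive times, so the path is started at
    \<open>t > t0\<close> and \<open>t\<close> then tends to \<open>t0\<close>; this covers
    \<open>t0 = 0\<close>.\<close>
  define f where "f = (\<lambda>t. u (x + (t - t0) *\<^sub>R v, t) + c * (t1 - t))"
  have le: "u (x + (t1 - t0) *\<^sub>R v, t1) \<le> f t" if "t0 < t" "t \<le> t1" for t
  proof -
    let ?x = "(x + (t - t0) *\<^sub>R v, t)"
    have "u (?x + (t1 - t) *\<^sub>R (v, 1)) \<le> u ?x + c * (t1 - t)"
    proof (rule viscosity_sub_on_segment_le[OF sub, where S = "S \<times> {0<..}"])
      show "open (S \<times> {0::real<..})" using S by (intro open_Times) auto
      show "S \<times> {0::real<..} \<subseteq> V \<times> {0<..}" using S by auto
      show "continuous_on (S \<times> {0<..}) u"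
        by (rule continuous_on_subset[OF cont]) auto
      fix s assume s: "s \<in> {0..t1 - t}"
      then have "x + (t + s - t0) *\<^sub>R v \<in> S" using segment[of "t + s"] that by auto
      then show "?x + s *\<^sub>R (v, 1) \<in> S \<times> {0<..}"
        using s t that by (auto simp: algebra_simps)
    next
      fix y :: "(real^'n) \<times> real" and q assume "y \<in> S \<times> {0<..}"
      then show "(v, 1) \<bullet> q - c \<le> evolution_op H y q"
        using H_ge[of "fst y" "fst q"] by (auto simp: evolution_op_def inner_prod_def)
    qed (use that in auto)
    then show ?thesis by (simp add: f_def algebra_simps)
  qed
  have "continuous_on {t0..t1} (\<lambda>t. u (x + (t - t0) *\<^sub>R v, t))"
    by (rule continuous_on_compose2[OF cont]) (use segment t in \<open>auto intro!: continuous_intros\<close>)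
  then have "continuous_on {t0..t1} f"
    unfolding f_def by (intro continuous_intros)
  then have "(f \<longlongrightarrow> f t0) (at_right t0)"
    using \<open>t0 < t1\<close> by (rule continuous_on_Icc_at_rightD)
  moreover have "\<forall>\<^sub>F t in at_right t0. u (x + (t1 - t0) *\<^sub>R v, t1) \<le> f t"
    using eventually_at_right[OF \<open>t0 < t1\<close>] le \<open>t0 < t1\<close> by force
  ultimately have "u (x + (t1 - t0) *\<^sub>R v, t1) \<le> f t0"
    by (rule tendsto_lowerbound) simp
  then show ?thesis by (simp add: f_def)
qed simp

section \<open>Lower bounds for the effective Cauchy problem\<close>

text \<open>The affine function \<open>e \<bullet> x - t |e|^2 / 2\<close> solves the equation with
  Hamiltonian \<open>|p|^2 / 2\<close>. Subtracting a small multiple of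
  \<open>exp (K t) (1 + |x|^2)\<close> makes it a strict subsolution, and the growth hypothesis
  makes the difference from \<open>u\<close> coercive. A minimum at an interior time is then
  impossible, and at time 0 the difference is nonnegative.\<close>

lemma cauchy_super_affine_ge:
  fixes u :: "(real^'n) \<times> real \<Rightarrow> real" and e :: "real^'n"
  assumes cont: "continuous_on (UNIV \<times> {0..}) u"
    and super: "viscosity_super_on (UNIV \<times> {0<..}) (evolution_op (\<lambda>x. h)) u"
    and h_le: "\<And>p. h p \<le> (norm p)\<^sup>2 / 2"
    and init: "\<And>x. u (x, 0) = e \<bullet> x"
    and growth: "\<And>\<delta>. \<delta> > 0 \<Longrightarrow> \<exists>C. \<forall>x. \<forall>t\<in>{0..2}. - C - \<delta> * (norm x)\<^sup>2 \<le> u (x, t)"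
  shows "- (norm e)\<^sup>2 / 2 \<le> u (0, 1)"
proof -
  \<comment> \<open>The summand \<open>norm e\<close> absorbs the cross term
    \<open>2 (e \<bullet> x)\<close>; the summand 2 absorbs the square of the penalty gradient once
    \<open>\<epsilon> * exp (K * 2) < 1\<close>.\<close>
  define K where "K = norm e + 2"
  \<comment> \<open>The last term, tiny at time \<open>1\<close> and large at time \<open>2\<close>, keeps the minimum off time \<open>2\<close>.\<close>
  define \<phi> where "\<phi> = (\<lambda>\<epsilon> N (x, t). e \<bullet> x - t * ((norm e)\<^sup>2 / 2)
    - \<epsilon> * exp (K * t) * (1 + x \<bullet> x) - exp (N * (t - 3 / 2)) :: real)"
  define G where "G = (\<lambda>\<epsilon> N (x, t). (e - (2 * (\<epsilon> * exp (K * t))) *\<^sub>R x,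
    - ((norm e)\<^sup>2 / 2) - \<epsilon> * (K * exp (K * t)) * (1 + x \<bullet> x) - N * exp (N * (t - 3 / 2))))"
  have C1: "C1_with_gradient (\<phi> \<epsilon> N) (G \<epsilon> N)" for \<epsilon> N
    unfolding C1_with_gradient_def gderiv_def
  proof (intro conjI allI)
    show "continuous_on UNIV (G \<epsilon> N)"
      unfolding G_def case_prod_unfold by (intro continuous_intros)
    fix z :: "(real^'n) \<times> real"
    show "(\<phi> \<epsilon> N has_derivative (\<lambda>h. h \<bullet> G \<epsilon> N z)) (at z)"
      unfolding \<phi>_def G_def case_prod_unfold
      by (auto intro!: derivative_eq_intros ext simp: inner_prod_def inner_commute algebra_simps)
  qed
  \<comment> \<open>The assumption \<open>large\<close> excludes a minimum at time 2; it is secured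
    afterwards by the choice of \<open>N\<close>.\<close>
  have barrier: "0 \<le> u (0, 1) - \<phi> \<epsilon> N (0, 1)"
    if \<epsilon>: "\<epsilon> > 0" "\<epsilon> * exp (K * 2) < 1" and N: "N \<ge> 0"
      and large: "\<And>x. u (0, 1) - \<phi> \<epsilon> N (0, 1) < u (x, 2) - \<phi> \<epsilon> N (x, 2)"
    for \<epsilon> N
  proof -
    define f where "f = (\<lambda>z. u z - \<phi> \<epsilon> N z)"
    obtain C where C: "\<And>x t. t \<in> {0..2} \<Longrightarrow> - C - \<epsilon> / 2 * (norm x)\<^sup>2 \<le> u (x, t)"
      using growth[OF half_gt_zero[OF \<epsilon>(1)]] by blast
    \<comment> \<open>The growth bound for \<open>\<epsilon> / 2\<close> uses up half of the
      quadratic penalty; the other half dominates the linear term.\<close>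
    have f_ge: "- C + norm x * (\<epsilon> / 2 * norm x - norm e) \<le> f (x, t)" if "t \<in> {0..2}" for x t
    proof -
      have "e \<bullet> x \<le> norm e * norm x" by (rule norm_cauchy_schwarz)
      moreover have "\<epsilon> * 1 * (1 + x \<bullet> x) \<le> \<epsilon> * exp (K * t) * (1 + x \<bullet> x)"
        using \<epsilon> that by (intro mult_right_mono mult_left_mono) (auto simp: K_def add_nonneg_nonneg)
      moreover have "\<epsilon> * 1 * (1 + x \<bullet> x) = \<epsilon> + 2 * (\<epsilon> / 2 * (norm x)\<^sup>2)"
        by (simp add: power2_norm_eq_inner algebra_simps)
      moreover have "norm x * (\<epsilon> / 2 * norm x - norm e) = \<epsilon> / 2 * (norm x)\<^sup>2 - norm e * norm x"
        by (simp add: power2_eq_square algebra_simps)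
      moreover have "0 \<le> t * ((norm e)\<^sup>2 / 2)" using that by simp
      moreover have "f (x, t) = u (x, t) - e \<bullet> x + t * ((norm e)\<^sup>2 / 2)
          + \<epsilon> * exp (K * t) * (1 + x \<bullet> x) + exp (N * (t - 3 / 2))"
        by (simp add: f_def \<phi>_def)
      ultimately show ?thesis
        using C[OF that, of x] \<epsilon>(1) exp_gt_zero[of "N * (t - 3 / 2)"] by linarith
    qed
    \<comment> \<open>Makes the lower bound \<open>f_ge\<close> exceed \<open>f (0, 1)\<close>
      beyond radius \<open>R\<close>; \<open>R \<ge> 1\<close> lets the factor \<open>norm x\<close>
      be dropped there.\<close>
    define R where "R = 1 + 2 * (norm e + \<bar>f (0, 1)\<bar> + \<bar>C\<bar> + 1) / \<epsilon>"
    have "R \<ge> 1" using \<epsilon> by (simp add: R_def)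
    have outside: "f (0, 1) < f (x, t)" if "t \<in> {0..2}" "norm x \<ge> R" for x t
    proof -
      have "\<epsilon> / 2 * R \<ge> norm e + \<bar>f (0, 1)\<bar> + \<bar>C\<bar> + 1"
        using \<epsilon> by (simp add: R_def field_simps)
      moreover have "\<epsilon> / 2 * norm x \<ge> \<epsilon> / 2 * R" using that \<epsilon> by simp
      ultimately have "\<bar>f (0, 1)\<bar> + \<bar>C\<bar> + 1 \<le> \<epsilon> / 2 * norm x - norm e" by linarith
      also have "\<dots> \<le> norm x * (\<epsilon> / 2 * norm x - norm e)"
        using calculation that \<open>R \<ge> 1\<close> mult_right_mono[of 1 "norm x" "\<epsilon> / 2 * norm x - norm e"]
        by auto
      finally show ?thesis using f_ge[OF that(1), of x] by linarith
    qed
    let ?Q = "cball (0::real^'n) R \<times> {0..2::real}"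
    have "continuous_on UNIV (\<phi> \<epsilon> N)"
      unfolding \<phi>_def case_prod_unfold by (intro continuous_intros)
    then have "continuous_on ?Q f"
      unfolding f_def
      by (intro continuous_on_diff continuous_on_subset[OF cont]
          continuous_on_subset[where s = UNIV and t = ?Q]) auto
    moreover have "compact ?Q" by (intro compact_Times) auto
    moreover have "(0, 1) \<in> ?Q" using \<open>R \<ge> 1\<close> by simp
    ultimately obtain z where z: "z \<in> ?Q" "\<And>z'. z' \<in> ?Q \<Longrightarrow> f z \<le> f z'"
      using continuous_attains_inf[of ?Q f] by blast
    obtain x t where z_eq: "z = (x, t)" by (cases z)
    have fz: "f (x, t) \<le> f (0, 1)" using z \<open>(0, 1) \<in> ?Q\<close> z_eq by blast
    have t: "t \<in> {0..2}" using z z_eq by auto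
    have "norm x < R" using fz outside[OF t, of x] by force
    have "t \<noteq> 2" using fz large[of x] unfolding f_def by force
    \<comment> \<open>At a time strictly between 0 and 2, \<open>\<phi>\<close> would touch
      \<open>u\<close> from below up to a constant, contradicting its strict subsolution
      inequality.\<close>
    have "t = 0"
    proof (rule ccontr)
      assume "t \<noteq> 0"
      then have "0 < t" "t < 2" using t \<open>t \<noteq> 2\<close> by auto
      have "\<forall>\<^sub>F z' in nhds z. z' \<in> ball 0 R \<times> {0<..<2}"
        using \<open>norm x < R\<close> \<open>0 < t\<close> \<open>t < 2\<close>
        by (intro eventually_nhds_in_open open_Times) (auto simp: z_eq)
      then have "\<forall>\<^sub>F z' in at z within UNIV \<times> {0<..}. z' \<in> ball 0 R \<times> {0<..<2}"
        unfolding eventually_at_filter by (rule eventually_mono) simp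
      then have "\<forall>\<^sub>F z' in at z within UNIV \<times> {0<..}. u z' - \<phi> \<epsilon> N z' \<ge> u z - \<phi> \<epsilon> N z"
      proof (rule eventually_mono)
        fix z' :: "(real^'n) \<times> real" assume "z' \<in> ball 0 R \<times> {0<..<2}"
        then have "z' \<in> ?Q" by auto
        then show "u z' - \<phi> \<epsilon> N z' \<ge> u z - \<phi> \<epsilon> N z" using z(2) by (simp add: f_def)
      qed
      with super C1 \<open>0 < t\<close> have "evolution_op (\<lambda>x. h) z (G \<epsilon> N z) \<ge> 0"
        unfolding viscosity_super_on_def z_eq by blast
      moreover define E where "E = \<epsilon> * exp (K * t)"
      ultimately have "0 \<le> - ((norm e)\<^sup>2 / 2) - E * K * (1 + x \<bullet> x) - N * exp (N * (t - 3 / 2))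
          + h (e - (2 * E) *\<^sub>R x)"
        by (simp add: evolution_op_def G_def z_eq E_def algebra_simps)
      also have "\<dots> \<le> - ((norm e)\<^sup>2 / 2) - E * K * (1 + x \<bullet> x) + (norm (e - (2 * E) *\<^sub>R x))\<^sup>2 / 2"
        using h_le[of "e - (2 * E) *\<^sub>R x"] N by (auto intro: order_trans[rotated])
      also have "\<dots> = E * (2 * E * (x \<bullet> x) - 2 * (e \<bullet> x) - K * (1 + x \<bullet> x))"
        unfolding power2_norm_eq_inner by (simp add: inner_commute inner_diff field_simps)
      also have "\<dots> < 0"
      proof -
        have "E > 0" using \<epsilon> by (simp add: E_def)
        have "E \<le> \<epsilon> * exp (K * 2)"
          unfolding E_def using \<epsilon> \<open>t < 2\<close>
          by (intro mult_left_mono iffD2[OF exp_le_cancel_iff]) (auto simp: K_def)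
        then have "E < 1" using \<epsilon> by simp
        have "- (2 * (e \<bullet> x)) \<le> norm e * (2 * norm x)"
          using norm_cauchy_schwarz[of "- e" x] by simp
        also have "\<dots> \<le> norm e * (1 + x \<bullet> x)"
          using sum_squares_bound[of 1 "norm x"]
          by (intro mult_left_mono) (auto simp flip: power2_norm_eq_inner)
        finally have "2 * E * (x \<bullet> x) - 2 * (e \<bullet> x) - K * (1 + x \<bullet> x) \<le> 2 * E * (x \<bullet> x) - 2 * (1 + x \<bullet> x)"
          by (simp add: K_def algebra_simps)
        also have "\<dots> < 0" using \<open>E < 1\<close> mult_right_mono[of E 1 "x \<bullet> x"] by simp
        finally show ?thesis using \<open>E > 0\<close> by (simp add: mult_pos_neg)
      qed
      finally show False by simp
    qed
    have "f (x, 0) \<ge> 0"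
      using \<epsilon> by (simp add: f_def \<phi>_def init add_nonneg_nonneg)
    then show ?thesis using fz \<open>t = 0\<close> by (simp add: f_def)
  qed
  have "- (norm e)\<^sup>2 / 2 - \<epsilon> * exp K - \<epsilon> \<le> u (0, 1)"
    if \<epsilon>: "\<epsilon> > 0" "\<epsilon> * exp (K * 2) < 1" for \<epsilon>
  proof -
    obtain C where C: "\<And>x t. t \<in> {0..2} \<Longrightarrow> - C - \<epsilon> / 2 * (norm x)\<^sup>2 \<le> u (x, t)"
      using growth[OF half_gt_zero[OF \<epsilon>(1)]] by blast
    \<comment> \<open>\<open>A\<close> bounds the value at \<open>(0, 1)\<close> plus the possible
      loss at time 2. The last term of \<open>\<phi>\<close> has size \<open>Y > A\<close> at time 2
      but only \<open>1 / Y \<le> \<epsilon>\<close> at time 1.\<close>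
    define A where "A = \<bar>u (0, 1)\<bar> + (norm e)\<^sup>2 / 2 + \<epsilon> * exp K + 1 + \<bar>C\<bar> + (norm e)\<^sup>2 / (2 * \<epsilon>)"
    define Y where "Y = 1 + A + 1 / \<epsilon>"
    have "A \<ge> 0" using \<epsilon> by (simp add: A_def)
    have Y: "Y \<ge> 1" "Y > A" "1 / Y \<le> \<epsilon>" "1 / Y \<le> 1"
      using \<epsilon> \<open>A \<ge> 0\<close> by (auto simp: Y_def field_simps add_pos_nonneg)
    define N where "N = 2 * ln Y"
    have exps: "exp (N * (1 / 2)) = Y" "exp (N * (1 - 3 / 2)) = 1 / Y" "N \<ge> 0"
      using Y(1) by (auto simp: N_def exp_minus inverse_eq_divide)
    have "0 \<le> u (0, 1) - \<phi> \<epsilon> N (0, 1)"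
    proof (rule barrier[OF \<epsilon> exps(3)])
      fix x :: "real^'n"
      have "e \<bullet> x \<le> norm e * norm x" by (rule norm_cauchy_schwarz)
      moreover have "norm e * norm x \<le> (norm e)\<^sup>2 / (2 * \<epsilon>) + \<epsilon> / 2 * (norm x)\<^sup>2"
        using sum_squares_bound[of "norm e" "\<epsilon> * norm x"] \<epsilon>
        by (simp add: field_simps power2_eq_square)
      moreover have "\<epsilon> * 1 * (1 + x \<bullet> x) \<le> \<epsilon> * exp (K * 2) * (1 + x \<bullet> x)"
        using \<epsilon> by (intro mult_right_mono mult_left_mono) (auto simp: K_def add_nonneg_nonneg)
      moreover have "\<epsilon> * 1 * (1 + x \<bullet> x) = \<epsilon> + 2 * (\<epsilon> / 2 * (norm x)\<^sup>2)"
        by (simp add: power2_norm_eq_inner algebra_simps)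
      moreover have "- C - \<epsilon> / 2 * (norm x)\<^sup>2 \<le> u (x, 2)" by (rule C) simp
      moreover have "\<phi> \<epsilon> N (x, 2) = e \<bullet> x - (norm e)\<^sup>2 - \<epsilon> * exp (K * 2) * (1 + x \<bullet> x) - Y"
        using exps(1) by (simp add: \<phi>_def)
      ultimately have "- \<bar>C\<bar> - (norm e)\<^sup>2 / (2 * \<epsilon>) + Y \<le> u (x, 2) - \<phi> \<epsilon> N (x, 2)"
        using \<epsilon>(1) zero_le_power2[of "norm e"] by linarith
      moreover have "u (0, 1) - \<phi> \<epsilon> N (0, 1) \<le> \<bar>u (0, 1)\<bar> + (norm e)\<^sup>2 / 2 + \<epsilon> * exp K + 1"
        using exps(2) Y(4) by (simp add: \<phi>_def)
      ultimately show "u (0, 1) - \<phi> \<epsilon> N (0, 1) < u (x, 2) - \<phi> \<epsilon> N (x, 2)"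
        using Y(2) unfolding A_def by linarith
    qed
    then show ?thesis using exps(2) Y(3) by (simp add: \<phi>_def)
  qed
  then have "\<forall>\<^sub>F \<epsilon> in at_right 0. \<epsilon> * exp (K * 2) < 1 \<longrightarrow> - (norm e)\<^sup>2 / 2 - \<epsilon> * exp K - \<epsilon> \<le> u (0, 1)"
    using eventually_at_right_less[of "0::real"] by (auto elim: eventually_mono)
  moreover have "((\<lambda>\<epsilon>. \<epsilon> * exp (K * 2)) \<longlongrightarrow> 0 * exp (K * 2)) (at_right 0)"
    by (intro tendsto_intros)
  then have "\<forall>\<^sub>F \<epsilon> in at_right 0. \<epsilon> * exp (K * 2) < 1"
    by (rule order_tendstoD) simp
  ultimately have "\<forall>\<^sub>F \<epsilon> in at_right 0. - (norm e)\<^sup>2 / 2 - \<epsilon> * exp K - \<epsilon> \<le> u (0, 1)"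
    by eventually_elim simp
  moreover have "((\<lambda>\<epsilon>. - (norm e)\<^sup>2 / 2 - \<epsilon> * exp K - \<epsilon>) \<longlongrightarrow> - (norm e)\<^sup>2 / 2 - 0 * exp K - 0) (at_right 0)"
    by (intro tendsto_intros)
  ultimately show ?thesis
    by (intro tendsto_upperbound[where F = "at_right 0"]) auto
qed

text \<open>Every point \<open>(x, t)\<close> is joined by a straight path to one fixed point
  \<open>(0, T)\<close>. The cost \<open>\<kappa> |x|^2 / (2 (T - t))\<close> is small relative to
  \<open>|x|^2\<close> when \<open>T\<close> is large, so the single value \<open>u (0, T)\<close>
  controls \<open>u\<close> from below.\<close>

lemma cauchy_sub_growth:
  fixes u :: "(real^'n) \<times> real \<Rightarrow> real"
  assumes cont: "continuous_on (UNIV \<times> {0..}) u"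
    and sub: "viscosity_sub_on (UNIV \<times> {0<..}) (evolution_op (\<lambda>x. h)) u"
    and h_ge: "\<And>p. (norm p)\<^sup>2 / (2 * \<kappa>) \<le> h p"
    and pos: "\<kappa> > 0" "\<delta> > 0" "t0 \<ge> 0"
  shows "\<exists>C. \<forall>x. \<forall>t\<in>{0..t0}. - C - \<delta> * (norm x)\<^sup>2 \<le> u (x, t)"
proof -
  \<comment> \<open>The extra time \<open>\<kappa> / (2 * \<delta>)\<close> is what brings the cost
    down to \<open>\<delta> |x|^2\<close>.\<close>
  define T where "T = t0 + \<kappa> / (2 * \<delta>)"
  have "- \<bar>u (0, T)\<bar> - \<delta> * (norm x)\<^sup>2 \<le> u (x, t)" if t: "t \<in> {0..t0}" for x t
  proof -
    have T: "T - t \<ge> \<kappa> / (2 * \<delta>)" "T - t > 0" using t pos by (auto simp: T_def add_pos_pos le_less_trans add_nonneg_pos)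
    define v where "v = (- 1 / (T - t)) *\<^sub>R x"
    define c where "c = \<kappa> * (norm v)\<^sup>2 / 2"
    have "u (x + (T - t) *\<^sub>R v, T) \<le> u (x, t) + c * (T - t)"
    proof (rule evolution_sub_segment_le[OF sub cont])
      fix p :: "real^'n"
      have "0 \<le> (norm (p - \<kappa> *\<^sub>R v))\<^sup>2 / (2 * \<kappa>)" using pos by simp
      also have "\<dots> = (norm p)\<^sup>2 / (2 * \<kappa>) - v \<bullet> p + c"
        using pos unfolding power2_norm_eq_inner c_def
        by (simp add: inner_commute inner_diff field_simps power2_eq_square)
      finally show "v \<bullet> p - c \<le> h p" using h_ge[of p] by linarith
    qed (use T t in auto)
    moreover have "x + (T - t) *\<^sub>R v = 0" using T by (simp add: v_def)
    moreover have "c * (T - t) \<le> \<delta> * (norm x)\<^sup>2"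
    proof -
      have "c * (T - t) = \<kappa> / (2 * (T - t)) * (norm x)\<^sup>2"
      proof -
        have "\<kappa> * (a / \<tau>)\<^sup>2 / 2 * \<tau> = \<kappa> / (2 * \<tau>) * a\<^sup>2" if "\<tau> > 0" for a \<tau> :: real
          using that by (simp add: field_simps power2_eq_square)
        then show ?thesis using T by (simp add: c_def v_def)
      qed
      also have "\<dots> \<le> \<delta> * (norm x)\<^sup>2"
        using T pos by (intro mult_right_mono) (auto simp: field_simps)
      finally show ?thesis .
    qed
    ultimately show ?thesis by simp
  qed
  then show ?thesis by blast
qed

section \<open>The integer lattice and periodicity of the perforated domain\<close>

lemma int_lattice_add: "m \<in> int_lattice \<Longrightarrow> m' \<in> int_lattice \<Longrightarrow> m + m' \<in> int_lattice"
  by (simp add: int_lattice_def)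

lemma int_lattice_uminus: "m \<in> int_lattice \<Longrightarrow> - m \<in> int_lattice"
  by (simp add: int_lattice_def)

lemma int_lattice_scaleR_axis: "c \<in> \<int> \<Longrightarrow> c *\<^sub>R axis i 1 \<in> int_lattice"
  by (auto simp: int_lattice_def axis_def)

lemma mem_perforated: "x \<in> perforated M D \<longleftrightarrow> (\<forall>m\<in>M. x - m \<notin> closure D)"
  unfolding perforated_def by (force simp: image_iff algebra_simps)

lemma closure_translation_invariant:
  fixes S :: "'a::real_normed_vector set"
  assumes "\<And>x. x \<in> S \<Longrightarrow> x + m \<in> S" and "x \<in> closure S"
  shows "x + m \<in> closure S"
proof -
  have "(\<lambda>x. m + x) ` S \<subseteq> S" using assms(1) by (auto simp: add.commute)
  then have "closure ((\<lambda>x. m + x) ` S) \<subseteq> closure S" by (rule closure_mono)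
  then have "(\<lambda>x. m + x) ` closure S \<subseteq> closure S" by (simp only: closure_translation)
  then show ?thesis using assms(2) by (auto simp: add.commute)
qed

lemma perforated_int_lattice_add:
  fixes x m :: "real^'n"
  assumes "x \<in> perforated int_lattice D" "m \<in> int_lattice"
  shows "x + m \<in> perforated int_lattice D"
  unfolding mem_perforated
proof
  fix m' :: "real^'n" assume "m' \<in> int_lattice"
  then have "m' - m \<in> int_lattice"
    using int_lattice_add[OF _ int_lattice_uminus[OF assms(2)]] by simp
  with assms(1) have "x - (m' - m) \<notin> closure D" by (simp add: mem_perforated)
  then show "x + m - m' \<notin> closure D" by (simp add: algebra_simps)
qed

section \<open>Bounds on the cell problem constant\<close>

text \<open>Young's inequality; \<open>(norm v)\<^sup>2 / (2 * \<alpha>)\<close> is the Lagrangian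
  for the lower bound \<open>\<alpha>\<close> of the coefficient.\<close>

lemma quadratic_ge_affine:
  fixes v p :: "'a::real_inner"
  assumes "1 \<le> \<alpha>" "\<alpha> \<le> a"
  shows "v \<bullet> p - (norm v)\<^sup>2 / (2 * \<alpha>) \<le> a * (norm p)\<^sup>2 / 2"
proof -
  have "0 \<le> (norm (\<alpha> *\<^sub>R p - v))\<^sup>2 / (2 * \<alpha>)" using assms by simp
  also have "\<dots> = \<alpha> * (norm p)\<^sup>2 / 2 - v \<bullet> p + (norm v)\<^sup>2 / (2 * \<alpha>)"
    using assms unfolding power2_norm_eq_inner
    by (simp add: inner_commute inner_diff field_simps power2_eq_square)
  also have "\<alpha> * (norm p)\<^sup>2 / 2 \<le> a * (norm p)\<^sup>2 / 2"
    using assms by (intro divide_right_mono mult_right_mono) auto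
  finally show ?thesis by linarith
qed

text \<open>Periodicity gives the corrector a global minimum on \<open>closure \<Omega>\<close>,
  where a constant is a test function. The supersolution property on the closure admits a minimum on
  the boundary of a hole.\<close>

lemma cell_solution_constant_le:
  fixes p :: "real^'n"
  assumes cell: "cell_solution \<Omega> H p c v"
    and invariant: "\<And>y m. y \<in> \<Omega> \<Longrightarrow> m \<in> int_lattice \<Longrightarrow> y + m \<in> \<Omega>"
    and "\<Omega> \<noteq> {}"
    and H_le: "\<And>y. y \<in> closure \<Omega> \<Longrightarrow> H y p \<le> C"
  shows "c \<le> C"
proof -
  define Q where "Q = cbox (0::real^'n) (\<chi> i. 1)"
  have shift: "\<exists>m\<in>int_lattice. y + m \<in> Q" for y
  proof (intro bexI)
    show "(\<chi> i. - of_int \<lfloor>y $ i\<rfloor>) \<in> int_lattice" by (simp add: int_lattice_def)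
    show "y + (\<chi> i. - of_int \<lfloor>y $ i\<rfloor>) \<in> Q"
      by (auto simp: Q_def mem_box_cart) linarith
  qed
  have closure_invariant: "y + m \<in> closure \<Omega>" if "y \<in> closure \<Omega>" "m \<in> int_lattice" for y m
    using closure_translation_invariant[of \<Omega> m y] invariant that by blast
  have v: "continuous_on (closure \<Omega>) v" "lattice_periodic_on (closure \<Omega>) v"
    "viscosity_super_on (closure \<Omega>) (\<lambda>y q. H y (p + q) - c) v"
    using cell by (auto simp: cell_solution_def)
  have "compact (closure \<Omega> \<inter> Q)" unfolding Q_def by (intro closed_Int_compact) auto
  moreover have "closure \<Omega> \<inter> Q \<noteq> {}"
  proof -
    obtain y where "y \<in> closure \<Omega>" using \<open>\<Omega> \<noteq> {}\<close> closure_subset by blast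
    with shift[of y] closure_invariant show ?thesis by blast
  qed
  moreover have "continuous_on (closure \<Omega> \<inter> Q) v" by (rule continuous_on_subset[OF v(1)]) auto
  ultimately obtain y0 where y0: "y0 \<in> closure \<Omega>" "\<forall>y\<in>closure \<Omega> \<inter> Q. v y0 \<le> v y"
    using continuous_attains_inf[of "closure \<Omega> \<inter> Q" v] by blast
  have "v y0 \<le> v y" if "y \<in> closure \<Omega>" for y
  proof -
    obtain m where "m \<in> int_lattice" "y + m \<in> Q" using shift by blast
    moreover from this have "v (y + m) = v y"
      using v(2) that unfolding lattice_periodic_on_def by blast
    ultimately show ?thesis
      using y0(2) closure_invariant[OF that] by (metis IntI)
  qed
  then have "\<forall>\<^sub>F y in at y0 within closure \<Omega>. v y - 0 \<ge> v y0 - 0"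
    unfolding eventually_at_filter by (auto intro: always_eventually)
  moreover have "C1_with_gradient (\<lambda>y::real^'n. 0) (\<lambda>y. 0)"
    using C1_with_gradient_quadratic[of 0 "0 :: real^'n"] by simp
  ultimately have "H y0 (p + 0) - c \<ge> 0"
    using v(3) y0(1) unfolding viscosity_super_on_def by blast
  then show ?thesis using H_le[OF y0(1)] by simp
qed

text \<open>Along the line the corrector grows at rate at most
  \<open>c - (p $ i)\<^sup>2 / 2\<close>; after one period it returns to its value, so this rate
  cannot be negative.\<close>

lemma cell_solution_constant_ge:
  fixes p :: "real^'n"
  assumes cell: "cell_solution \<Omega> H p c v"
    and S: "open S" "S \<subseteq> \<Omega>"
    and line: "\<And>s. x + s *\<^sub>R axis i 1 \<in> S"
    and H_ge: "\<And>y q. y \<in> S \<Longrightarrow> (norm q)\<^sup>2 / 2 \<le> H y q"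
  shows "(p $ i)\<^sup>2 / 2 \<le> c"
proof -
  \<comment> \<open>This velocity maximises \<open>p \<bullet> b - |b|^2 / 2\<close> among multiples
    of the axis vector.\<close>
  define b where "b = (p $ i) *\<^sub>R (axis i 1 :: real^'n)"
  \<comment> \<open>The time to traverse one period; for \<open>p $ i = 0\<close> the path is
    constant and any positive time serves.\<close>
  define T where "T = (if p $ i = 0 then 1 else 1 / \<bar>p $ i\<bar>)"
  have "T > 0" by (simp add: T_def)
  have v: "continuous_on (closure \<Omega>) v" "lattice_periodic_on (closure \<Omega>) v"
    "viscosity_sub_on \<Omega> (\<lambda>y q. H y (p + q) - c) v"
    using cell by (auto simp: cell_solution_def)
  have "p \<bullet> b = (p $ i)\<^sup>2" "(norm b)\<^sup>2 = (p $ i)\<^sup>2"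
    by (auto simp: b_def inner_axis power2_eq_square abs_mult)
  have "v (x + T *\<^sub>R b) \<le> v x + (c - (p $ i)\<^sup>2 / 2) * T"
  proof (rule viscosity_sub_on_segment_le[OF v(3) S])
    show "continuous_on S v" using S(2) closure_subset by (blast intro: continuous_on_subset[OF v(1)])
    show "x + s *\<^sub>R b \<in> S" for s using line[of "s * p $ i"] by (simp add: b_def)
    fix y q assume "y \<in> S"
    have "b \<bullet> (p + q) - (norm b)\<^sup>2 / (2 * 1) \<le> 1 * (norm (p + q))\<^sup>2 / 2"
      by (rule quadratic_ge_affine) auto
    then show "b \<bullet> q - (c - (p $ i)\<^sup>2 / 2) \<le> H y (p + q) - c"
      using H_ge[OF \<open>y \<in> S\<close>, of "p + q"] \<open>p \<bullet> b = _\<close> \<open>(norm b)\<^sup>2 = _\<close>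
      by (simp add: inner_add inner_commute)
  qed (use \<open>T > 0\<close> in auto)
  moreover have "v (x + T *\<^sub>R b) = v x"
  proof -
    have "T *\<^sub>R b = sgn (p $ i) *\<^sub>R axis i 1"
      by (auto simp: T_def b_def sgn_if)
    then have "T *\<^sub>R b \<in> int_lattice" by (simp add: int_lattice_scaleR_axis sgn_if)
    moreover have "x \<in> closure \<Omega>" using line[of 0] S(2) closure_subset by auto
    ultimately show ?thesis using v(2) by (simp add: lattice_periodic_on_def)
  qed
  ultimately show ?thesis using \<open>T > 0\<close> by (simp add: zero_le_mult_iff)
qed

section \<open>Regions that avoid the holes\<close>

text \<open>By compactness the hole stays a positive distance from the faces of the cube. The slab
  between two layers of holes contains full lines in every direction
  \<open>i \<noteq> j\<close>.\<close>

lemma perforated_slab: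
  fixes D :: "(real^'n) set" and j :: 'n
  assumes "closure D \<subseteq> {x. \<forall>i. -1/2 < x $ i \<and> x $ i < 1/2}"
  obtains \<delta> where "\<delta> > 0" "{y. \<bar>y $ j - 1 / 2\<bar> < \<delta>} \<subseteq> perforated int_lattice D"
proof -
  have abs_less: "\<bar>x $ i\<bar> < 1 / 2" if "x \<in> closure D" for x i
  proof -
    have "-1/2 < x $ i \<and> x $ i < 1/2" using assms that by blast
    then show ?thesis by linarith
  qed
  have "closure D \<subseteq> cbox (\<chi> i. -1/2) (\<chi> i. 1/2)"
  proof
    fix x assume "x \<in> closure D"
    then have "-1/2 < x $ i \<and> x $ i < 1/2" for i using assms by blast
    then show "x \<in> cbox (\<chi> i. -1/2) (\<chi> i. 1/2)" by (auto simp: mem_box_cart less_imp_le)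
  qed
  then have "compact (closure D)"
    by (meson bounded_cbox bounded_subset closed_closure compact_eq_bounded_closed)
  obtain \<rho> where \<rho>: "\<rho> < 1 / 2" "\<And>x. x \<in> closure D \<Longrightarrow> \<bar>x $ j\<bar> \<le> \<rho>"
  proof (cases "closure D = {}")
    case True
    then show ?thesis using that[of 0] by auto
  next
    case False
    have "continuous_on (closure D) (\<lambda>x. \<bar>x $ j\<bar>)" by (intro continuous_intros)
    from continuous_attains_sup[OF \<open>compact (closure D)\<close> False this] obtain x0
      where "x0 \<in> closure D" "\<forall>x\<in>closure D. \<bar>x $ j\<bar> \<le> \<bar>x0 $ j\<bar>" by blast
    then show ?thesis using that[of "\<bar>x0 $ j\<bar>"] abs_less by blast
  qed
  have "{y. \<bar>y $ j - 1 / 2\<bar> < 1 / 2 - \<rho>} \<subseteq> perforated int_lattice D"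
  proof
    fix y :: "real^'n" assume y: "y \<in> {y. \<bar>y $ j - 1 / 2\<bar> < 1 / 2 - \<rho>}"
    show "y \<in> perforated int_lattice D"
      unfolding mem_perforated
    proof
      fix m :: "real^'n" assume "m \<in> int_lattice"
      then obtain z :: int where z: "m $ j = of_int z"
        unfolding int_lattice_def by (auto elim: Ints_cases)
      have "1 / 2 \<le> \<bar>1 / 2 - real_of_int z\<bar>"
        by (cases "z \<le> 0") (auto simp: abs_if)
      then have "\<bar>y $ j - real_of_int z\<bar> > \<rho>" using y unfolding mem_Collect_eq by linarith
      then have "\<bar>(y - m) $ j\<bar> > \<rho>" using z by simp
      then show "y - m \<notin> closure D" using \<rho>(2) by fastforce
    qed
  qed
  then show ?thesis using that[of "1 / 2 - \<rho>"] \<rho>(1) by simp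
qed

text \<open>A translate of the hole by \<open>m\<close> meeting this half-tube has
  \<open>m $ i = 0\<close> for \<open>i \<noteq> k\<close> and \<open>m $ k > -1\<close>, so it is
  one of the filled holes. The half-tube is a neighbourhood of the ray to be travelled.\<close>

lemma perforated_ray:
  fixes D :: "(real^'n) set" and k :: 'n
  assumes D: "closure D \<subseteq> {x. \<forall>i. -1/2 < x $ i \<and> x $ i < 1/2}"
  shows "{x. -1/2 < x $ k \<and> (\<forall>i. i \<noteq> k \<longrightarrow> \<bar>x $ i\<bar> < 1/2)}
    \<subseteq> perforated (int_lattice - {real m *\<^sub>R axis k 1 | m. m \<in> UNIV}) D"
proof
  fix x :: "real^'n" assume x: "x \<in> {x. -1/2 < x $ k \<and> (\<forall>i. i \<noteq> k \<longrightarrow> \<bar>x $ i\<bar> < 1/2)}"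
  show "x \<in> perforated (int_lattice - {real m *\<^sub>R axis k 1 | m. m \<in> UNIV}) D"
    unfolding mem_perforated
  proof (rule ballI, rule notI)
    fix m assume m: "m \<in> int_lattice - {real m *\<^sub>R axis k 1 | m. m \<in> UNIV}"
      and "x - m \<in> closure D"
    then have close: "-1/2 < x $ i - m $ i" "x $ i - m $ i < 1/2" for i
      using D by force+
    have int: "\<exists>z::int. m $ i = of_int z" for i
      using m unfolding int_lattice_def by (blast elim: Ints_cases)
    have "m $ i = 0" if "i \<noteq> k" for i
    proof -
      obtain z :: int where z: "m $ i = of_int z" using int by blast
      have "\<bar>x $ i\<bar> < 1/2" using x that by simp
      then have "\<bar>real_of_int z\<bar> < 1" using close[of i] z by linarith
      then have "z = 0" by linarith
      then show ?thesis using z by simp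
    qed
    moreover obtain z :: int where z: "m $ k = of_int z" using int by blast
    moreover have "z > -1"
    proof -
      have "real_of_int z > -1" using close[of k] x z by simp
      then show ?thesis by linarith
    qed
    ultimately have "m = real (nat z) *\<^sub>R axis k 1"
      by (auto simp: vec_eq_iff axis_def)
    then show False using m by blast
  qed
qed

section \<open>Cost of travelling through the filled holes\<close>

text \<open>Each full period of length \<open>\<epsilon>\<close> contains a stretch of length
  \<open>\<epsilon> * \<rho>\<close> with cost rate \<open>1 / (2 * \<alpha>)\<close> instead of
  \<open>1 / 2\<close>. At least \<open>1 / \<epsilon> - 1\<close> full periods fit into the
  path.\<close>

lemma axis_travel_le:
  fixes w :: "(real^'n) \<times> real \<Rightarrow> real" and k :: 'n and a :: "real^'n \<Rightarrow> real"
  assumes sol: "state_constraint_solution ((\<lambda>x. \<epsilon> *\<^sub>R x) ` W) (\<lambda>x p. a ((1 / \<epsilon>) *\<^sub>R x) * (norm p)\<^sup>2 / 2)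
      (\<lambda>x. - (x $ k)) w"
    and "\<epsilon> > 0"
    and S0: "open S0" "S0 \<subseteq> W" "\<And>s. s \<ge> 0 \<Longrightarrow> s *\<^sub>R axis k 1 \<in> S0"
    and a_ge_1: "\<And>y. 1 \<le> a y"
    and \<alpha>: "1 \<le> \<alpha>" "\<And>y j. norm (y - real j *\<^sub>R axis k 1) < 2 * \<rho> \<Longrightarrow> \<alpha> \<le> a y"
    and \<rho>: "0 < \<rho>" "\<rho> < 1"
  shows "w (0, 1) \<le> - 1 / 2 - \<rho> * (1 / 2 - 1 / (2 * \<alpha>)) * (1 - \<epsilon>)"
proof -
  define e where "e = (axis k 1 :: real^'n)"
  have "norm e = 1" by (simp add: e_def)
  \<comment> \<open>The value along the unit speed path from \<open>e\<close> at time 0 to the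
    origin at time 1.\<close>
  define f where "f = (\<lambda>s. w ((1 - s) *\<^sub>R e, s))"
  let ?V = "(\<lambda>x. \<epsilon> *\<^sub>R x) ` W"
  \<comment> \<open>The sets \<open>S1\<close> live in unscaled coordinates, where \<open>a\<close>
    is evaluated.\<close>
  have step: "f s2 \<le> f s1 + (s2 - s1) / (2 * \<beta>)"
    if s: "0 \<le> s1" "s1 \<le> s2" "s2 \<le> 1" and "1 \<le> \<beta>"
      and S1: "open S1" "S1 \<subseteq> S0" "\<And>y. y \<in> S1 \<Longrightarrow> \<beta> \<le> a y"
      and in_S1: "\<And>t. t \<in> {s1..s2} \<Longrightarrow> ((1 - t) / \<epsilon>) *\<^sub>R e \<in> S1"
    for s1 s2 \<beta> S1
  proof -
    define S where "S = (\<lambda>x. (1 / \<epsilon>) *\<^sub>R x) -` S1"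
    have "open S"
      unfolding S_def by (intro open_vimage S1 continuous_intros)
    have "S \<subseteq> ?V"
    proof
      fix x assume "x \<in> S"
      then have "(1 / \<epsilon>) *\<^sub>R x \<in> W" using S1 S0 by (auto simp: S_def)
      then show "x \<in> ?V" using \<open>\<epsilon> > 0\<close> by (intro image_eqI[of _ _ "(1 / \<epsilon>) *\<^sub>R x"]) auto
    qed
    have "w ((1 - s1) *\<^sub>R e + (s2 - s1) *\<^sub>R (- e), s2) \<le> w ((1 - s1) *\<^sub>R e, s1) + 1 / (2 * \<beta>) * (s2 - s1)"
    proof (rule evolution_sub_segment_le[OF _ _ \<open>open S\<close> \<open>S \<subseteq> ?V\<close> s(1,2)])
      show "viscosity_sub_on (?V \<times> {0<..}) (evolution_op (\<lambda>x p. a ((1 / \<epsilon>) *\<^sub>R x) * (norm p)\<^sup>2 / 2)) w"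
        using sol by (simp add: state_constraint_solution_def)
      have "continuous_on (closure ?V \<times> {0..}) w"
        using sol by (simp add: state_constraint_solution_def)
      then show "continuous_on (S \<times> {0..}) w"
        by (rule continuous_on_subset) (use \<open>S \<subseteq> ?V\<close> closure_subset in blast)
      fix t assume "t \<in> {s1..s2}"
      moreover have "(1 - s1) *\<^sub>R e + (t - s1) *\<^sub>R - e = (1 - t) *\<^sub>R e"
        by (simp add: algebra_simps)
      ultimately show "(1 - s1) *\<^sub>R e + (t - s1) *\<^sub>R - e \<in> S"
        using in_S1[of t] by (simp add: S_def)
    next
      fix y p :: "real^'n" assume "y \<in> S"
      then have "- e \<bullet> p - (norm (- e))\<^sup>2 / (2 * \<beta>) \<le> a ((1 / \<epsilon>) *\<^sub>R y) * (norm p)\<^sup>2 / 2"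
        using \<open>1 \<le> \<beta>\<close> S1 by (intro quadratic_ge_affine) (auto simp: S_def)
      then show "- e \<bullet> p - 1 / (2 * \<beta>) \<le> a ((1 / \<epsilon>) *\<^sub>R y) * (norm p)\<^sup>2 / 2"
        by (simp add: \<open>norm e = 1\<close>)
    qed
    moreover have "(1 - s1) *\<^sub>R e + (s2 - s1) *\<^sub>R - e = (1 - s2) *\<^sub>R e"
      by (simp add: algebra_simps)
    ultimately show ?thesis by (simp add: f_def)
  qed
  have slow: "f s2 \<le> f s1 + (s2 - s1) / 2" if "0 \<le> s1" "s1 \<le> s2" "s2 \<le> 1" for s1 s2
    using step[OF that, of 1 S0] S0 a_ge_1 that \<open>\<epsilon> > 0\<close> by (simp add: e_def)
  define \<kappa> where "\<kappa> = \<rho> * (1 / 2 - 1 / (2 * \<alpha>))"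
  have "\<kappa> \<ge> 0" using \<rho> \<alpha>(1) by (simp add: \<kappa>_def)
  \<comment> \<open>The induction runs backwards in time, outwards from the origin. The cell at
    distances from \<open>\<epsilon> * real j\<close> to \<open>\<epsilon> * real (Suc j)\<close> is
    cheap in its part nearest the origin.\<close>
  have cells: "f 1 \<le> f (1 - \<epsilon> * real j) + real j * (\<epsilon> / 2 - \<epsilon> * \<kappa>)" if "\<epsilon> * real j \<le> 1" for j
    using that
  proof (induction j)
    case (Suc j)
    let ?s0 = "1 - \<epsilon> * real (Suc j)" and ?s1 = "1 - \<epsilon> * (real j + \<rho>)" and ?s2 = "1 - \<epsilon> * real j"
    have s: "0 \<le> ?s0" "?s0 \<le> ?s1" "?s1 \<le> ?s2" "?s2 \<le> 1"
      using Suc.prems \<open>\<epsilon> > 0\<close> \<rho> by auto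
    \<comment> \<open>Radius \<open>2 * \<rho>\<close> leaves an open neighbourhood around the
      closed stretch of length \<open>\<rho>\<close>.\<close>
    let ?S = "S0 \<inter> ball (real j *\<^sub>R e) (2 * \<rho>)"
    have "f ?s2 \<le> f ?s1 + (?s2 - ?s1) / (2 * \<alpha>)"
    proof (rule step)
      show "open ?S" using S0 by auto
      show "\<alpha> \<le> a y" if "y \<in> ?S" for y
        using that \<alpha>(2)[of y j] by (simp add: e_def dist_norm norm_minus_commute)
      fix t assume t: "t \<in> {?s1..?s2}"
      then have b: "real j \<le> (1 - t) / \<epsilon>" "(1 - t) / \<epsilon> \<le> real j + \<rho>"
        using \<open>\<epsilon> > 0\<close> by (auto simp: field_simps)
      then have "((1 - t) / \<epsilon>) *\<^sub>R e \<in> S0" unfolding e_def by (intro S0) linarith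
      moreover have "dist (real j *\<^sub>R e) (((1 - t) / \<epsilon>) *\<^sub>R e) = \<bar>real j - (1 - t) / \<epsilon>\<bar>"
        by (simp add: dist_norm \<open>norm e = 1\<close> flip: scaleR_diff_left)
      ultimately show "((1 - t) / \<epsilon>) *\<^sub>R e \<in> ?S" using b \<rho> by (simp add: \<open>norm e = 1\<close>)
    qed (use s \<alpha> in auto)
    moreover have "f ?s1 \<le> f ?s0 + (?s1 - ?s0) / 2" using s by (intro slow) auto
    moreover have "f 1 \<le> f ?s2 + real j * (\<epsilon> / 2 - \<epsilon> * \<kappa>)"
      using s by (intro Suc.IH) auto
    moreover have "(?s2 - ?s1) / (2 * \<alpha>) + (?s1 - ?s0) / 2 + real j * (\<epsilon> / 2 - \<epsilon> * \<kappa>)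
        = real (Suc j) * (\<epsilon> / 2 - \<epsilon> * \<kappa>)"
      using \<alpha>(1) by (simp add: \<kappa>_def field_simps)
    ultimately show ?case by linarith
  qed simp
  \<comment> \<open>The number of full periods within unit length; the remainder, at most
    \<open>\<epsilon>\<close> long, is charged at the rate \<open>1 / 2\<close>.\<close>
  define N where "N = nat \<lfloor>1 / \<epsilon>\<rfloor>"
  have "real N = of_int \<lfloor>1 / \<epsilon>\<rfloor>" using \<open>\<epsilon> > 0\<close> by (simp add: N_def)
  then have "real N \<le> 1 / \<epsilon>" "1 / \<epsilon> - 1 \<le> real N" by linarith+
  then have N: "\<epsilon> * real N \<le> 1" "1 - \<epsilon> \<le> \<epsilon> * real N"
    using \<open>\<epsilon> > 0\<close> by (auto simp: field_simps)
  have "f 0 = - 1"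
  proof -
    have "(1 / \<epsilon>) *\<^sub>R e \<in> W"
      unfolding e_def using \<open>\<epsilon> > 0\<close> by (intro subsetD[OF S0(2)] S0(3)) simp
    moreover have "e = \<epsilon> *\<^sub>R ((1 / \<epsilon>) *\<^sub>R e)" using \<open>\<epsilon> > 0\<close> by simp
    ultimately have "e \<in> ?V" by (rule rev_image_eqI)
    then have "e \<in> closure ?V" by (rule subsetD[OF closure_subset])
    then show ?thesis using sol by (simp add: f_def state_constraint_solution_def e_def)
  qed
  have "f 1 \<le> f (1 - \<epsilon> * real N) + real N * (\<epsilon> / 2 - \<epsilon> * \<kappa>)" by (rule cells[OF N(1)])
  also have "f (1 - \<epsilon> * real N) \<le> f 0 + (1 - \<epsilon> * real N) / 2"
    using slow[of 0 "1 - \<epsilon> * real N"] N(1) \<open>\<epsilon> > 0\<close> by simp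
  also have "f 0 + (1 - \<epsilon> * real N) / 2 + real N * (\<epsilon> / 2 - \<epsilon> * \<kappa>) = - 1 / 2 - \<kappa> * (\<epsilon> * real N)"
    by (simp add: \<open>f 0 = - 1\<close> field_simps)
  also have "\<dots> \<le> - 1 / 2 - \<kappa> * (1 - \<epsilon>)"
    using mult_left_mono[OF N(2) \<open>\<kappa> \<ge> 0\<close>] by linarith
  finally show ?thesis by (simp add: f_def \<kappa>_def)
qed

section \<open>Effective Hamiltonian bounds, the value of \<open>u\<close>, and the strict gap for
  \<open>w\<close>\<close>

theorem lemma6p5:
  fixes k :: "'n::finite"
    and D \<Omega> I W :: "(real^'n) set"
    and a :: "real^'n \<Rightarrow> real"
    and H :: "real^'n \<Rightarrow> real^'n \<Rightarrow> real"
    and Hbar g :: "real^'n \<Rightarrow> real"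
    and w :: "real \<Rightarrow> (real^'n) \<times> real \<Rightarrow> real"
    and u :: "(real^'n) \<times> real \<Rightarrow> real"
  assumes dim: "CARD('n) \<ge> 2"
    and D_open: "open D"
    and D_connected: "connected D"
    and D_inside: "closure D \<subseteq> {x. \<forall>i. -1/2 < x $ i \<and> x $ i < 1/2}"
    and D_boundary: "C1_boundary D"
    and D_zero: "0 \<in> D"
    and \<Omega>_eq: "\<Omega> = perforated int_lattice D"
    and \<Omega>_connected: "connected \<Omega>"
    and a_continuous: "continuous_on UNIV a"
    and a_periodic: "lattice_periodic_on UNIV a"
    and a_eq_1: "\<And>y. y \<in> closure \<Omega> \<Longrightarrow> a y = 1"
    and a_gt_1: "\<And>y. y \<notin> closure \<Omega> \<Longrightarrow> a y > 1"
    and H_eq: "\<And>y p. H y p = a y * (norm p)\<^sup>2 / 2"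
    and I_eq: "I = {real m *\<^sub>R axis k 1 | m. m \<in> (UNIV :: nat set)}"
    and W_eq: "W = perforated (int_lattice - I) D"
    and g_eq: "\<And>x. g x = - (x $ k)"
    and w_solution: "\<And>\<epsilon>. \<epsilon> > 0 \<Longrightarrow>
          state_constraint_solution ((\<lambda>x. \<epsilon> *\<^sub>R x) ` W) (\<lambda>x. H ((1 / \<epsilon>) *\<^sub>R x)) g (w \<epsilon>)"
    and Hbar_effective: "effective_hamiltonian \<Omega> H Hbar"
    and u_solution: "cauchy_solution Hbar g u"
  shows "Limsup (at_right 0) (\<lambda>\<epsilon>. ereal (w \<epsilon> (0, 1))) < ereal (u (0, 1)) \<and> u (0, 1) = - 1 / 2"
proof -
  have a_ge_1: "1 \<le> a y" for y using a_eq_1[of y] a_gt_1[of y] by (cases "y \<in> closure \<Omega>") auto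
  have cell: "\<exists>v. cell_solution \<Omega> H p (Hbar p) v" for p
    using Hbar_effective by (simp add: effective_hamiltonian_def)
  \<comment> \<open>Dimension at least two provides \<open>j \<noteq> i\<close>, so that a line in
    direction \<open>i\<close> fits into the slab around \<open>y $ j = 1 / 2\<close>.\<close>
  have Hbar_lower: "(p $ i)\<^sup>2 / 2 \<le> Hbar p" for p i
  proof -
    obtain j where "j \<noteq> i"
    proof -
      have "UNIV \<noteq> {i}"
      proof
        assume "UNIV = {i}"
        then have "CARD('n) = card {i}" by (rule arg_cong)
        with dim show False by simp
      qed
      then show ?thesis using that by blast
    qed
    from perforated_slab[OF D_inside, of j] obtain \<delta>
      where \<delta>: "\<delta> > 0" "{y. \<bar>y $ j - 1 / 2\<bar> < \<delta>} \<subseteq> \<Omega>" unfolding \<Omega>_eq by blast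
    obtain v where "cell_solution \<Omega> H p (Hbar p) v" using cell by blast
    then show ?thesis
    proof (rule cell_solution_constant_ge[OF _ _ \<delta>(2)])
      show "open {y::real^'n. \<bar>y $ j - 1 / 2\<bar> < \<delta>}"
        by (intro open_Collect_less continuous_intros)
      show "(1 / 2) *\<^sub>R axis j 1 + s *\<^sub>R axis i 1 \<in> {y::real^'n. \<bar>y $ j - 1 / 2\<bar> < \<delta>}" for s
        using \<open>j \<noteq> i\<close> \<delta>(1) by (simp add: axis_def)
      show "(norm q)\<^sup>2 / 2 \<le> H y q" for y q :: "real^'n"
        using mult_right_mono[OF a_ge_1[of y], of "(norm q)\<^sup>2"] by (simp add: H_eq)
    qed
  qed
  have Hbar_upper: "Hbar p \<le> (norm p)\<^sup>2 / 2" for p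
  proof -
    obtain v where "cell_solution \<Omega> H p (Hbar p) v" using cell by blast
    then show ?thesis
    proof (rule cell_solution_constant_le)
      show "y + m \<in> \<Omega>" if "y \<in> \<Omega>" "m \<in> int_lattice" for y m
        using perforated_int_lattice_add that unfolding \<Omega>_eq by blast
      obtain \<delta> where "\<delta> > 0" "{y. \<bar>y $ k - 1 / 2\<bar> < \<delta>} \<subseteq> \<Omega>"
        using perforated_slab[OF D_inside, of k] unfolding \<Omega>_eq by blast
      moreover have "(1 / 2) *\<^sub>R axis k 1 \<in> {y::real^'n. \<bar>y $ k - 1 / 2\<bar> < \<delta>}"
        using \<open>\<delta> > 0\<close> by simp
      ultimately show "\<Omega> \<noteq> {}" by blast
    qed (simp add: H_eq a_eq_1)
  qed
  have u: "continuous_on (UNIV \<times> {0..}) u"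
    "viscosity_sub_on (UNIV \<times> {0<..}) (evolution_op (\<lambda>x. Hbar)) u"
    "viscosity_super_on (UNIV \<times> {0<..}) (evolution_op (\<lambda>x. Hbar)) u"
    "\<And>x. u (x, 0) = - (x $ k)"
    using u_solution by (auto simp: cauchy_solution_def g_eq)
  have "u (0, 1) = - 1 / 2"
  proof (rule antisym)
    \<comment> \<open>Unit speed motion from the axis vector, where \<open>u\<close> is initially
      -1, to the origin at cost \<open>1 / 2\<close>.\<close>
    have "u (axis k 1 + (1 - 0) *\<^sub>R - axis k 1, 1) \<le> u (axis k 1, 0) + 1 / 2 * (1 - 0)"
    proof (rule evolution_sub_segment_le[OF u(2) u(1)])
      fix p :: "real^'n"
      have "0 \<le> (p $ k + 1)\<^sup>2 / 2" by simp
      also have "\<dots> = (p $ k)\<^sup>2 / 2 + p $ k + 1 / 2" by (simp add: power2_eq_square field_simps)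
      finally show "- axis k 1 \<bullet> p - 1 / 2 \<le> Hbar p"
        using Hbar_lower[of p k] by (simp add: inner_axis' )
    qed auto
    then show "u (0, 1) \<le> - 1 / 2" by (simp add: u(4))
  next
    have "- (norm (- axis k 1 :: real^'n))\<^sup>2 / 2 \<le> u (0, 1)"
    proof (rule cauchy_super_affine_ge[OF u(1,3) Hbar_upper])
      show "u (x, 0) = - axis k 1 \<bullet> x" for x by (simp add: u(4) inner_axis')
      show "\<exists>C. \<forall>x. \<forall>t\<in>{0..2}. - C - \<delta> * (norm x)\<^sup>2 \<le> u (x, t)" if "\<delta> > 0" for \<delta>
      proof (rule cauchy_sub_growth[OF u(1,2)])
        fix p :: "real^'n"
        \<comment> \<open>Summing the coordinatewise bounds over \<open>i\<close> gives quadratic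
          growth of \<open>Hbar\<close> with the dimension in the role of
          \<open>\<kappa>\<close>.\<close>
        have "(norm p)\<^sup>2 = (\<Sum>i\<in>UNIV. (p $ i)\<^sup>2)"
          by (simp add: norm_vec_def L2_set_def sum_nonneg)
        also have "\<dots> \<le> (\<Sum>i\<in>(UNIV::'n set). 2 * Hbar p)"
          using Hbar_lower[of p] by (intro sum_mono) (simp add: field_simps)
        finally show "(norm p)\<^sup>2 / (2 * real CARD('n)) \<le> Hbar p"
          by (simp add: field_simps)
      qed (use that in auto)
    qed
    then show "- 1 / 2 \<le> u (0, 1)" by simp
  qed
  moreover have "Limsup (at_right 0) (\<lambda>\<epsilon>. ereal (w \<epsilon> (0, 1))) < ereal (- 1 / 2)"
  proof -
    define S0 where "S0 = {x::real^'n. - 1 / 2 < x $ k \<and> (\<forall>i. i \<noteq> k \<longrightarrow> \<bar>x $ i\<bar> < 1 / 2)}"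
    have "open S0"
    proof -
      have "S0 = {x. - 1 / 2 < x $ k} \<inter> (\<Inter>i\<in>UNIV - {k}. {x. \<bar>x $ i\<bar> < 1 / 2})"
        by (auto simp: S0_def)
      then show ?thesis
        by (auto intro!: open_Int open_INT open_Collect_less continuous_intros)
    qed
    have "S0 \<subseteq> W"
      using perforated_ray[OF D_inside, of k] unfolding S0_def W_eq I_eq by simp
    have axis_S0: "s *\<^sub>R axis k 1 \<in> S0" if "s \<ge> 0" for s
      using that by (auto simp: S0_def axis_def)
    have "0 \<notin> closure \<Omega>"
    proof -
      have "x \<notin> \<Omega>" if "x \<in> D" for x
      proof -
        have "x - 0 \<in> closure D" using that closure_subset by auto
        moreover have "0 \<in> int_lattice" by (simp add: int_lattice_def)
        ultimately show ?thesis unfolding \<Omega>_eq mem_perforated by blast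
      qed
      then have "D \<inter> \<Omega> = {}" by blast
      then show ?thesis using D_zero open_Int_closure_eq_empty[OF D_open, of \<Omega>] by blast
    qed
    then have "1 < a 0" by (rule a_gt_1)
    \<comment> \<open>The midpoint leaves room on both sides: above 1 for a strict saving, below
      \<open>a 0\<close> for continuity to give \<open>\<alpha> \<le> a\<close> near 0.\<close>
    define \<alpha> where "\<alpha> = (1 + a 0) / 2"
    have \<alpha>: "1 < \<alpha>" "\<alpha> < a 0" using \<open>1 < a 0\<close> by (auto simp: \<alpha>_def)
    obtain d where d: "d > 0" "\<And>y. dist y 0 < d \<Longrightarrow> dist (a y) (a 0) < a 0 - \<alpha>"
      using a_continuous \<alpha>(2) unfolding continuous_on_iff by (metis UNIV_I diff_gt_0_iff_gt)
    define \<rho> where "\<rho> = min (d / 2) (1 / 2)"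
    have \<rho>: "0 < \<rho>" "\<rho> < 1" "2 * \<rho> \<le> d" using d(1) by (auto simp: \<rho>_def)
    have a_ge: "\<alpha> \<le> a y" if "norm (y - real j *\<^sub>R axis k 1) < 2 * \<rho>" for y j
    proof -
      let ?m = "real j *\<^sub>R axis k 1 :: real^'n"
      have "?m \<in> int_lattice" by (rule int_lattice_scaleR_axis) simp
      then have "a y = a (y - ?m)"
        using a_periodic unfolding lattice_periodic_on_def by (metis UNIV_I diff_add_cancel)
      moreover have "dist (a (y - ?m)) (a 0) < a 0 - \<alpha>"
        using that \<rho>(3) by (intro d(2)) (simp add: dist_norm)
      ultimately show ?thesis by (simp add: dist_real_def)
    qed
    define \<kappa> where "\<kappa> = \<rho> * (1 / 2 - 1 / (2 * \<alpha>))"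
    have "\<kappa> > 0" using \<rho> \<alpha> by (simp add: \<kappa>_def)
    \<comment> \<open>Restricting to \<open>\<epsilon> < 1 / 2\<close> makes
      \<open>1 - \<epsilon>\<close> at least \<open>1 / 2\<close>, so the saving is bounded below
      uniformly.\<close>
    have "w \<epsilon> (0, 1) \<le> - 1 / 2 - \<kappa> / 2" if "\<epsilon> > 0" "\<epsilon> < 1 / 2" for \<epsilon>
    proof -
      have "H = (\<lambda>y p. a y * (norm p)\<^sup>2 / 2)" "g = (\<lambda>x. - (x $ k))" by (intro ext H_eq g_eq)+
      with w_solution[OF \<open>\<epsilon> > 0\<close>]
      have "state_constraint_solution ((\<lambda>x. \<epsilon> *\<^sub>R x) ` W)
          (\<lambda>x p. a ((1 / \<epsilon>) *\<^sub>R x) * (norm p)\<^sup>2 / 2) (\<lambda>x. - (x $ k)) (w \<epsilon>)" by simp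
      from axis_travel_le[OF this \<open>\<epsilon> > 0\<close> \<open>open S0\<close> \<open>S0 \<subseteq> W\<close> axis_S0 a_ge_1 less_imp_le[OF \<alpha>(1)] a_ge \<rho>(1,2)]
      have "w \<epsilon> (0, 1) \<le> - 1 / 2 - \<kappa> * (1 - \<epsilon>)" by (simp add: \<kappa>_def)
      also have "\<dots> \<le> - 1 / 2 - \<kappa> * (1 / 2)"
        using that \<open>\<kappa> > 0\<close> by (intro diff_left_mono mult_left_mono) auto
      finally show ?thesis by simp
    qed
    then have "\<forall>\<^sub>F \<epsilon> in at_right 0. ereal (w \<epsilon> (0, 1)) \<le> ereal (- 1 / 2 - \<kappa> / 2)"
      using eventually_at_right_real[of 0 "1 / 2"] by (auto elim: eventually_mono)
    then have "Limsup (at_right 0) (\<lambda>\<epsilon>. ereal (w \<epsilon> (0, 1))) \<le> ereal (- 1 / 2 - \<kappa> / 2)"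
      by (rule Limsup_bounded)
    also have "\<dots> < ereal (- 1 / 2)" using \<open>\<kappa> > 0\<close> by simp
    finally show ?thesis .
  qed
  ultimately show ?thesis by simp
qed

end
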